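(* As the real number $p\to\infty$, $$\frac1\pi\int_{-\infty}^{\infty}\left(\frac{\sin^2 t}{t^2}\right)^p dt\ \sim\ \frac{\sqrt{3/\pi}}{\sqrt p}.$$
   Context: Here $p$ is a real number with $p\ge 1$, the integrand $\sin^2 t/t^2$ is taken to be $1$ at $t=0$, and $f(p)\sim g(p)$ as $p\to\infty$ means $\lim_{p\to\infty} f(p)/g(p)=1$. *)

theory Defs
  imports "HOL-Analysis.Analysis" "HOL-Library.Landau_Symbols"
begin

definition sin_quot_sq :: "real \<Rightarrow> real" where
  "sin_quot_sq t = (if t = 0 then 1 else (sin t)\<^sup>2 / t\<^sup>2)"

end

theory Submission
  imports Defs "HOL-Probability.Sinc_Integral" "HOL-Probability.Distributions" "HOL-Real_Asymp.Real_Asymp"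
begin

text \<open>
  This is Laplace's method. Near its maximum \<open>0\<close> the quotient \<open>sin\<^sup>2 t / t\<^sup>2\<close> behaves
  like \<open>1 - t\<^sup>2 / 3\<close>, so its \<open>p\<close>-th power lives on the scale \<open>t = s / sqrt p\<close>. The substitution
  (\<open>integral_sin_quot_sq_rescale\<close>) extracts the factor \<open>1 / sqrt p\<close>, and the new integrand tends
  pointwise to \<open>exp (- s\<^sup>2 / 3)\<close> (\<open>tendsto_sin_quot_sq_rescaled\<close>), whose integral is
  \<open>sqrt (3 * pi)\<close>; dividing by \<open>pi\<close> gives the constant \<open>sqrt (3 / pi)\<close>.

  Limit and integral may be exchanged because one integrable function bounds all rescaled integrands
  with \<open>p \<ge> 1\<close>. It comes from the global estimate
  \<open>sin\<^sup>2 t / t\<^sup>2 \<le> 1 / (1 + t\<^sup>2 / 4)\<close>, which combines well with Bernoulli's inequality: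
  \<open>(1 + s\<^sup>2 / (4 p))\<^sup>p \<ge> 1 + s\<^sup>2 / 4\<close>, a bound that no longer involves \<open>p\<close>
  (\<open>sin_quot_sq_rescaled_le\<close>).
\<close>

text \<open>
  The half-angle formula \<open>sin\<^sup>2 t = 4 u (1 - u)\<close> with \<open>u = sin\<^sup>2 (t / 2) \<le> t\<^sup>2 / 4\<close> avoids
  Taylor estimates: since \<open>4 u (1 - u)\<close> is increasing for \<open>u \<le> 1 / 2\<close>, it yields
  \<open>sin\<^sup>2 t \<le> t\<^sup>2 (1 - t\<^sup>2 / 4)\<close> as long as \<open>t\<^sup>2 \<le> 2\<close>. For larger \<open>t\<close> the right-hand side is at
  least \<open>1\<close>. Any constant below \<open>1 / 3\<close> would fit the expansion at \<open>0\<close>; \<open>1 / 4\<close> is the one that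
  this argument gives.
\<close>
lemma sin_squared_le: "(sin t)\<^sup>2 \<le> t\<^sup>2 / (1 + t\<^sup>2 / 4)" for t :: real
proof (cases "t\<^sup>2 \<le> 2")
  case True
  define u where "u = (sin (t / 2))\<^sup>2"
  have "\<bar>sin (t / 2)\<bar> \<le> \<bar>t / 2\<bar>"
    by (rule abs_sin_x_le_abs_x)
  then have "u \<le> t\<^sup>2 / 4"
    unfolding u_def by (simp only: abs_le_square_iff) (simp add: power_divide)
  have "(sin t)\<^sup>2 = 4 * u * (1 - u)"
    using sin_double[of "t / 2"]
    by (simp add: u_def power_mult_distrib cos_squared_eq)
  also have "\<dots> \<le> t\<^sup>2 * (1 - t\<^sup>2 / 4)"
  proof -
    \<comment> \<open>With \<open>a = t\<^sup>2 / 4\<close>, this product is \<open>a (1 - a) - u (1 - u)\<close>.\<close>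
    have "0 \<le> (t\<^sup>2 / 4 - u) * (1 - u - t\<^sup>2 / 4)"
      using \<open>u \<le> t\<^sup>2 / 4\<close> True by (intro mult_nonneg_nonneg) auto
    then show ?thesis
      by (simp add: algebra_simps power2_eq_square)
  qed
  also have "\<dots> \<le> t\<^sup>2 / (1 + t\<^sup>2 / 4)"
  proof -
    have "(1 - t\<^sup>2 / 4) * (1 + t\<^sup>2 / 4) \<le> 1"
      using zero_le_power2[of "t\<^sup>2 / 4"] by (simp add: algebra_simps power2_eq_square)
    moreover have "0 < 1 + t\<^sup>2 / 4"
      by (simp add: add_pos_nonneg)
    ultimately have "1 - t\<^sup>2 / 4 \<le> 1 / (1 + t\<^sup>2 / 4)"
      by (simp add: pos_le_divide_eq)
    from mult_left_mono[OF this, of "t\<^sup>2"] show ?thesis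
      by simp
  qed
  finally show ?thesis .
next
  case False
  then have "1 \<le> t\<^sup>2 / (1 + t\<^sup>2 / 4)"
    by (simp add: field_simps)
  moreover have "(sin t)\<^sup>2 \<le> 1"
    by (simp add: abs_square_le_1)
  ultimately show ?thesis
    by linarith
qed

lemma sin_quot_sq_nonneg: "0 \<le> sin_quot_sq t"
  by (simp add: sin_quot_sq_def)

lemma sin_quot_sq_le: "sin_quot_sq t \<le> 1 / (1 + t\<^sup>2 / 4)"
  using sin_squared_le[of t] by (auto simp: sin_quot_sq_def divide_simps mult_ac)

text \<open>
  For a real exponent this is the weighted inequality of arithmetic and geometric means, applied to
  \<open>1 + p x\<close> with weight \<open>1 / p\<close> and to \<open>1\<close> with the remaining weight.
\<close>
lemma Bernoulli_inequality_powr: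
  fixes p x :: real
  assumes "1 \<le> p" "0 \<le> x"
  shows "1 + p * x \<le> (1 + x) powr p"
proof -
  have "(1 + p * x) powr (1 / p) * 1 powr (1 - 1 / p) \<le> 1 / p * (1 + p * x) + (1 - 1 / p) * 1"
    using assms by (intro Youngs_inequality_0) (auto simp: add_pos_nonneg)
  also have "\<dots> = 1 + x"
    using assms by (simp add: field_simps)
  finally have "((1 + p * x) powr (1 / p)) powr p \<le> (1 + x) powr p"
    using assms by (intro powr_mono2) auto
  then show ?thesis
    using assms by (simp add: powr_powr add_nonneg_nonneg)
qed

lemma sin_quot_sq_rescaled_le:
  assumes "1 \<le> p"
  shows "sin_quot_sq (s / sqrt p) powr p \<le> 1 / (1 + (s / 2)\<^sup>2)"
proof -
  define x where "x = (s / sqrt p)\<^sup>2 / 4"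
  have "0 \<le> x" and px: "p * x = (s / 2)\<^sup>2"
    using assms by (auto simp: x_def power_divide)
  have "sin_quot_sq (s / sqrt p) powr p \<le> (1 / (1 + x)) powr p"
    using sin_quot_sq_le[of "s / sqrt p"] sin_quot_sq_nonneg[of "s / sqrt p"] assms
    by (intro powr_mono2) (auto simp: x_def)
  also have "\<dots> = 1 / (1 + x) powr p"
    using \<open>0 \<le> x\<close> by (simp add: powr_divide)
  also have "\<dots> \<le> 1 / (1 + p * x)"
    using Bernoulli_inequality_powr[OF assms \<open>0 \<le> x\<close>] \<open>0 \<le> x\<close> assms
    by (intro divide_left_mono mult_pos_pos) (auto simp: add_pos_nonneg)
  finally show ?thesis
    by (simp only: px)
qed

lemma integrable_Cauchy_kernel_half: "integrable lborel (\<lambda>s::real. 1 / (1 + (s / 2)\<^sup>2))"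
proof -
  have "integrable lborel (\<lambda>x::real. inverse (1 + x\<^sup>2))"
    using integrable_inverse_1_plus_square by (simp add: set_integrable_def)
  from lborel_integrable_real_affine[OF this, of "1 / 2" 0] show ?thesis
    by (simp add: inverse_eq_divide)
qed

text \<open>
  Setting \<open>x = s / sqrt p\<close>, so that \<open>p = s\<^sup>2 / x\<^sup>2\<close>, reduces the pointwise limits for all
  \<open>s \<noteq> 0\<close> to this single expansion at \<open>0\<close>.
\<close>
lemma tendsto_sin_quot_sq_powr_at_0:
  "((\<lambda>x. sin_quot_sq x powr (1 / x\<^sup>2)) \<longlongrightarrow> exp (- 1 / 3)) (at 0)"
proof (rule Lim_transform_eventually)
  show "((\<lambda>x::real. ((sin x)\<^sup>2 / x\<^sup>2) powr (1 / x\<^sup>2)) \<longlongrightarrow> exp (- 1 / 3)) (at 0)"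
    by real_asymp
  show "\<forall>\<^sub>F x in at 0. ((sin x)\<^sup>2 / x\<^sup>2) powr (1 / x\<^sup>2) = sin_quot_sq x powr (1 / x\<^sup>2)"
    by (auto simp: sin_quot_sq_def eventually_at_filter)
qed

lemma tendsto_sin_quot_sq_rescaled:
  "((\<lambda>p. sin_quot_sq (s / sqrt p) powr p) \<longlongrightarrow> exp (- (s\<^sup>2 / 3))) at_top"
proof (cases "s = 0")
  case True
  then show ?thesis by (simp add: sin_quot_sq_def)
next
  case False
  have "filterlim (\<lambda>p. s / sqrt p) (at 0) at_top"
  proof (rule filterlim_atI)
    show "((\<lambda>p. s / sqrt p) \<longlongrightarrow> 0) at_top"
      by real_asymp
    show "\<forall>\<^sub>F p in at_top. s / sqrt p \<noteq> 0"
      using eventually_gt_at_top[of 0] by eventually_elim (simp add: False)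
  qed
  from filterlim_compose[OF tendsto_sin_quot_sq_powr_at_0 this]
  have "((\<lambda>p. (sin_quot_sq (s / sqrt p) powr (1 / (s / sqrt p)\<^sup>2)) powr s\<^sup>2)
      \<longlongrightarrow> exp (- 1 / 3) powr s\<^sup>2) at_top"
    by (intro tendsto_powr tendsto_const) auto
  moreover have "exp (- 1 / 3) powr s\<^sup>2 = exp (- (s\<^sup>2 / 3))"
    by (simp add: powr_def)
  moreover have "\<forall>\<^sub>F p in at_top.
      (sin_quot_sq (s / sqrt p) powr (1 / (s / sqrt p)\<^sup>2)) powr s\<^sup>2
        = sin_quot_sq (s / sqrt p) powr p"
    using eventually_gt_at_top[of 0]
    by eventually_elim (simp add: powr_powr power_divide False)
  ultimately show ?thesis
    using Lim_transform_eventually by fastforce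
qed

text \<open>
  Up to the factor \<open>1 / sqrt (3 * pi)\<close>, the integrand is the density of the centred normal
  distribution of variance \<open>3 / 2\<close>.
\<close>
lemma gaussian_integral: "(LINT s|lborel. exp (- (s\<^sup>2 / 3))) = sqrt (3 * pi)"
proof -
  have "normal_density 0 (sqrt (3 / 2)) s = exp (- (s\<^sup>2 / 3)) / sqrt (3 * pi)" for s
    by (simp add: normal_density_def mult.commute)
  with integral_normal_density[of "sqrt (3 / 2)" 0] show ?thesis
    by simp
qed

lemma borel_measurable_sin_quot_sq [measurable]: "sin_quot_sq \<in> borel_measurable borel"
  unfolding sin_quot_sq_def[abs_def] by measurable

lemma tendsto_rescaled_integral:
  "((\<lambda>p. LINT s|lborel. sin_quot_sq (s / sqrt p) powr p) \<longlongrightarrow> sqrt (3 * pi)) at_top"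
  unfolding gaussian_integral[symmetric]
proof (rule integral_dominated_convergence_at_top[OF _ _ integrable_Cauchy_kernel_half])
  show "\<forall>\<^sub>F p in at_top. AE s in lborel.
          norm (sin_quot_sq (s / sqrt p) powr p) \<le> 1 / (1 + (s / 2)\<^sup>2)"
    using eventually_ge_at_top[of 1] by eventually_elim (simp add: sin_quot_sq_rescaled_le)
qed (auto intro: tendsto_sin_quot_sq_rescaled)

lemma integral_sin_quot_sq_rescale:
  assumes "0 < p"
  shows "(LINT t|lborel. sin_quot_sq t powr p)
           = (LINT s|lborel. sin_quot_sq (s / sqrt p) powr p) / sqrt p"
  using assms lborel_integral_real_affine[of "1 / sqrt p" "\<lambda>t. sin_quot_sq t powr p" 0]
  by simp

theorem proposition2:
  shows "(\<lambda>p::real. 1 / pi * (LINT t|lborel. sin_quot_sq t powr p))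
           \<sim>[at_top] (\<lambda>p. sqrt (3 / pi) / sqrt p)"
proof (rule asymp_equivI')
  let ?J = "\<lambda>p. LINT s|lborel. sin_quot_sq (s / sqrt p) powr p"
  have "((\<lambda>p. ?J p / sqrt (3 * pi)) \<longlongrightarrow> sqrt (3 * pi) / sqrt (3 * pi)) at_top"
    by (intro tendsto_intros tendsto_rescaled_integral) simp
  then have lim: "((\<lambda>p. ?J p / sqrt (3 * pi)) \<longlongrightarrow> 1) at_top"
    by simp
  have "pi * sqrt (3 / pi) = sqrt (3 * pi)"
    using real_sqrt_mult_self[of pi] by (simp add: real_sqrt_mult real_sqrt_divide field_simps)
  then have const: "sqrt (3 * pi) = pi * sqrt (3 / pi)" ..
  have "\<forall>\<^sub>F p in at_top. ?J p / sqrt (3 * pi)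
      = 1 / pi * (LINT t|lborel. sin_quot_sq t powr p) / (sqrt (3 / pi) / sqrt p)"
    using eventually_gt_at_top[of 0]
    by eventually_elim (simp only: const integral_sin_quot_sq_rescale, simp)
  with lim show "((\<lambda>p. 1 / pi * (LINT t|lborel. sin_quot_sq t powr p)
      / (sqrt (3 / pi) / sqrt p)) \<longlongrightarrow> 1) at_top"
    by (rule Lim_transform_eventually)
qed

end
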